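(* Let $k,m,n$ be positive integers with $m\le k$. The poset $L^k(m,n)$ is graded of rank $mn$.
   Context: Fix an integer $k\ge1$. A partition $\lambda=(\lambda_1\ge\dots\ge\lambda_\ell>0)$ is a finite (possibly empty) non-increasing sequence of positive integers, $|\lambda|=\sum_i\lambda_i$, $\ell(\lambda)$ is the number of parts, and $\lambda_i=0$ for $i>\ell(\lambda)$. Its diagram is the set of cells $(i,j)$ with $1\le j\le\lambda_i$ (row $i$, column $j$; row 1 is the lowest row, and "above" means larger row index). $\lambda\subseteq\mu$ means $\lambda_i\le\mu_i$ for all $i$. A partition is $k$-bounded if $\lambda_1\le k$; $\mathcal P^k$ is the set of $k$-bounded partitions. $(m^n)$ is the partition with $n$ parts equal to $m$. A finite poset is graded of rank $d$ if all its maximal chains have length $d$ (i.e. $d+1$ elements). For partitions $\rho\subseteq\gamma$, the skew diagram $\gamma/\rho$ is $\{(i,j):\rho_i<j\le\gamma_i\}$; the squares of $\rho$ are said to lie below $\gamma/\rho$. For a square $(i,j)\in\gamma$ (possibly in $\rho$), its hook-length in $\gamma/\rho$ is the number of cells of $\gamma/\rho$ of the form $(i,j')$ with $j'\ge j$ or $(i',j)$ with $i'\ge i$. For $\lambda\in\mathcal P^k$, the $k$-skew diagram $\lambda/^k$ is the unique skew diagram such that (i) row $i$ has $\lambda_i$ cells, (ii) no cell of the diagram has hook-length exceeding $k$, (iii) every square below the diagram has hook-length exceeding $k$. The column lengths of $\lambda/^k$ form a $k$-bounded partition, called the $k$-conjugate $\lambda^{\omega_k}$. For $\lambda,\mu\in\mathcal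 P^k$ write $\lambda\prec\!\!\cdot\,\mu$ when $\lambda\subseteq\mu$, $\lambda^{\omega_k}\subseteq\mu^{\omega_k}$ and $|\mu|-|\lambda|=1$. The partial order $\preceq$ on $\mathcal P^k$ is the reflexive-transitive closure of $\prec\!\!\cdot$; the resulting poset is $Y^k$. For $1\le m\le k$ and $n\ge1$, $L^k(m,n)=\{\mu\in\mathcal P^k:\mu\preceq(m^n)\}$ is the principal order ideal of $Y^k$ generated by $(m^n)$, ordered by $\preceq$. *)

theory Defs
  imports Main
begin

definition is_partition :: "nat list \<Rightarrow> bool" where
  "is_partition xs \<longleftrightarrow> sorted_wrt (\<ge>) xs \<and> (\<forall>x\<in>set xs. 0 < x)"

text \<open>Parts are indexed from 1; \<open>part xs i = 0\<close> beyond the length, and also for \<open>i = 0\<close>,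
  so that no diagram has cells in row 0.\<close>

definition part :: "nat list \<Rightarrow> nat \<Rightarrow> nat" where
  "part xs i = (if 1 \<le> i \<and> i \<le> length xs then xs ! (i - 1) else 0)"

definition contained :: "nat list \<Rightarrow> nat list \<Rightarrow> bool" where
  "contained xs ys \<longleftrightarrow> (\<forall>i\<ge>1. part xs i \<le> part ys i)"

definition bounded_partitions :: "nat \<Rightarrow> nat list set" where
  "bounded_partitions k = {xs. is_partition xs \<and> part xs 1 \<le> k}"

definition diagram :: "nat list \<Rightarrow> (nat \<times> nat) set" where
  "diagram xs = {(i, j). 1 \<le> j \<and> j \<le> part xs i}"

definition skew_cells :: "nat list \<Rightarrow> nat list \<Rightarrow> (nat \<times> nat) set" where
  "skew_cells \<gamma> \<rho> = {(i, j). part \<rho> i < j \<and> j \<le> part \<gamma> i}"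

definition hook_length :: "nat list \<Rightarrow> nat list \<Rightarrow> nat \<times> nat \<Rightarrow> nat" where
  "hook_length \<gamma> \<rho> = (\<lambda>(i, j). card {(i', j') \<in> skew_cells \<gamma> \<rho>.
     (i' = i \<and> j \<le> j') \<or> (j' = j \<and> i \<le> i')})"

definition is_k_skew :: "nat \<Rightarrow> nat list \<Rightarrow> nat list \<Rightarrow> nat list \<Rightarrow> bool" where
  "is_k_skew k xs \<gamma> \<rho> \<longleftrightarrow>
     is_partition \<gamma> \<and> is_partition \<rho> \<and> contained \<rho> \<gamma> \<and>
     (\<forall>i\<ge>1. card {j. (i, j) \<in> skew_cells \<gamma> \<rho>} = part xs i) \<and>
     (\<forall>c\<in>skew_cells \<gamma> \<rho>. hook_length \<gamma> \<rho> c \<le> k) \<and>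
     (\<forall>c\<in>diagram \<rho>. k < hook_length \<gamma> \<rho> c)"

text \<open>The skew diagram is represented by the pair \<open>(\<gamma>, \<rho>)\<close>. In general several pairs give the
  same set of cells, but not here: if the top row of \<open>\<gamma>\<close> had no cell of the skew diagram, its
  squares would lie below the diagram with hook-length 0. Hence \<open>\<gamma>\<close> has exactly \<open>length xs\<close> rows,
  each containing a cell, and the set of cells determines the pair.\<close>

definition k_skew :: "nat \<Rightarrow> nat list \<Rightarrow> nat list \<times> nat list" where
  "k_skew k xs = (THE (\<gamma>, \<rho>). is_k_skew k xs \<gamma> \<rho>)"

definition k_conjugate :: "nat \<Rightarrow> nat list \<Rightarrow> nat list" where
  "k_conjugate k xs = (case k_skew k xs of (\<gamma>, \<rho>) \<Rightarrow>
     map (\<lambda>j. card {i. (i, j) \<in> skew_cells \<gamma> \<rho>}) [1..<Suc (part \<gamma> 1)])"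

definition Y_cover :: "nat \<Rightarrow> nat list \<Rightarrow> nat list \<Rightarrow> bool" where
  "Y_cover k xs ys \<longleftrightarrow>
     xs \<in> bounded_partitions k \<and> ys \<in> bounded_partitions k \<and>
     contained xs ys \<and> contained (k_conjugate k xs) (k_conjugate k ys) \<and>
     sum_list ys = sum_list xs + 1"

definition Y_le :: "nat \<Rightarrow> nat list \<Rightarrow> nat list \<Rightarrow> bool" where
  "Y_le k = (Y_cover k)\<^sup>*\<^sup>*"

definition L_ideal :: "nat \<Rightarrow> nat \<Rightarrow> nat \<Rightarrow> nat list set" where
  "L_ideal k m n = {xs \<in> bounded_partitions k. Y_le k xs (replicate n m)}"

definition graded_poset_of_rank :: "'a set \<Rightarrow> ('a \<Rightarrow> 'a \<Rightarrow> bool) \<Rightarrow> nat \<Rightarrow> bool" where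
  "graded_poset_of_rank A le d \<longleftrightarrow>
     finite A \<and> partial_order_on A {(x, y). x \<in> A \<and> y \<in> A \<and> le x y} \<and>
     (\<forall>C. pred_on.maxchain A le C \<longrightarrow> card C = d + 1)"

end

theory Submission
  imports Defs
begin

text \<open>A chain of \<open>L\<^sup>k(m,n)\<close> can be refined until it meets every size from \<open>0\<close> to \<open>m n\<close> exactly once,
  because a cover raises the size by one, the ideal has the greatest element \<open>(m\<^sup>n)\<close>, and the empty
  partition is the only minimal element of \<open>Y\<^sup>k\<close>. The last point is the one with content: every
  nonempty \<open>k\<close>-bounded partition covers another one (\<open>Y_cover_decrement_last\<close>). The partition it
  covers can be obtained by deleting the last cell of the top row.

  To see that this deletion shrinks the \<open>k\<close>-conjugate, build the \<open>k\<close>-skew diagram from the top row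
  down, keeping only the column heights \<open>c\<close> of the part built so far. The hook of a square in the new
  row of length \<open>a\<close> that lies left of that row, or is its first cell, has length \<open>c j + a\<close>. So the
  hook conditions force the row to start right behind the columns with \<open>c j + a > k\<close>, and the new
  row adds one to the following \<open>a\<close> heights. In particular the \<open>k\<close>-skew diagram exists and is unique
  (\<open>is_k_skewI\<close>, \<open>is_k_skewD\<close>), and the \<open>k\<close>-conjugate lists the final heights (\<open>part_k_conjugate\<close>).

  Now run the construction twice, with top rows of length \<open>a + 1\<close> and \<open>a\<close> and the same rows below.
  After the top row the heights differ by one in a single column, and this stays true for each
  further row (\<open>heights_decrement_last\<close>): either both copies of the row occupy the same
  columns, or the extra cell pushes its copy one step to the right. In the second case the extra
  unit of height moves from the column just left of the pushed row to its last column.\<close>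

section \<open>Column heights\<close>

text \<open>For non-increasing, eventually zero heights \<open>c\<close> and \<open>a \<le> k\<close> this is the number of columns to the left of a new bottom row of
  length \<open>a\<close>. It is a least bound rather than the cardinality of \<open>{j. k < c j + a}\<close> because the
  value of \<open>c\<close> at \<open>0\<close> is unconstrained: columns are numbered from 1.\<close>

definition shift :: "nat \<Rightarrow> nat \<Rightarrow> (nat \<Rightarrow> nat) \<Rightarrow> nat" where
  "shift k a c = (LEAST s. \<forall>j>s. c j + a \<le> k)"

fun heights :: "nat \<Rightarrow> nat list \<Rightarrow> nat \<Rightarrow> nat" where
  "heights k [] j = 0"
| "heights k (a # as) j = heights k as j +
     (if shift k a (heights k as) < j \<and> j \<le> shift k a (heights k as) + a then 1 else 0)"

text \<open>These are the sequences of parts of partitions, indexed from 1.\<close>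

definition height_function :: "(nat \<Rightarrow> nat) \<Rightarrow> bool" where
  "height_function c \<longleftrightarrow> (\<forall>i j. 1 \<le> i \<longrightarrow> i \<le> j \<longrightarrow> c j \<le> c i) \<and> (\<exists>N. \<forall>j>N. c j = 0)"

lemma height_functionD: "height_function c \<Longrightarrow> 1 \<le> i \<Longrightarrow> i \<le> j \<Longrightarrow> c j \<le> c i"
  by (auto simp: height_function_def)

lemma right_of_shift:
  assumes "height_function c" "a \<le> k" "shift k a c < j"
  shows "c j + a \<le> k"
proof -
  obtain N where "\<forall>j>N. c j = 0"
    using assms(1) by (auto simp: height_function_def)
  then have "\<forall>j>N. c j + a \<le> k"
    using assms(2) by auto
  then have "\<forall>j>shift k a c. c j + a \<le> k"
    unfolding shift_def by (rule LeastI)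
  then show ?thesis
    using assms(3) by blast
qed

lemma left_of_shift:
  assumes "height_function c" "1 \<le> j" "j \<le> shift k a c"
  shows "k < c j + a"
proof (rule ccontr)
  assume "\<not> k < c j + a"
  then have "c i + a \<le> k" if "j - 1 < i" for i
    using height_functionD[OF assms(1,2), of i] that by linarith
  then have "shift k a c \<le> j - 1"
    unfolding shift_def by (intro Least_le allI impI)
  then show False
    using assms(2,3) by linarith
qed

lemma shift_eqI:
  assumes "height_function c" "a \<le> k"
    and "\<And>j. 1 \<le> j \<Longrightarrow> j \<le> s \<Longrightarrow> k < c j + a" and "c (Suc s) + a \<le> k"
  shows "shift k a c = s"
proof (rule antisym)
  show "shift k a c \<le> s"
    using left_of_shift[OF assms(1), of "Suc s" k a] assms(4) by fastforce
  show "s \<le> shift k a c"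
    using right_of_shift[OF assms(1,2), of s] assms(3)[of s] by fastforce
qed

lemma shift_mono:
  assumes "height_function c'" "a' \<le> k" "a \<le> a'" "\<And>j. c j \<le> c' j"
  shows "shift k a c \<le> shift k a' c'"
  unfolding shift_def[of k a c]
proof (rule Least_le, intro allI impI)
  fix j assume "shift k a' c' < j"
  then show "c j + a \<le> k"
    using right_of_shift[OF assms(1,2)] assms(3) assms(4)[of j] by fastforce
qed

text \<open>A new row keeps the heights non-increasing because at its left end there is already a strict
  descent: \<open>c\<close> exceeds \<open>k - a\<close> on the left and is at most \<open>k - a\<close> over the row.\<close>

lemma height_function_heights:
  "\<forall>x\<in>set xs. x \<le> k \<Longrightarrow> height_function (heights k xs)"
proof (induction xs)
  case Nil
  then show ?case by (simp add: height_function_def)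
next
  case (Cons a xs)
  let ?c = "heights k xs" and ?s = "shift k a (heights k xs)"
  have c: "height_function ?c" and a: "a \<le> k"
    using Cons by auto
  have "heights k (a # xs) j \<le> heights k (a # xs) i" if "1 \<le> i" "i \<le> j" for i j
  proof (cases "i \<le> ?s \<and> ?s < j")
    case True
    have "?c j < ?c i"
      using right_of_shift[OF c a, of j] left_of_shift[OF c that(1), of k a] True by linarith
    then show ?thesis by simp
  next
    case False
    then show ?thesis
      using height_functionD[OF c that] that(2) by auto
  qed
  moreover obtain N where "\<forall>j>N. ?c j = 0"
    using c by (auto simp: height_function_def)
  then have "\<forall>j>N + ?s + a. heights k (a # xs) j = 0"
    by simp
  ultimately show ?case
    unfolding height_function_def by blast
qed

lemma heights_snoc_0: "heights k (xs @ [0]) = heights k xs"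
proof (induction xs)
  case (Cons a xs)
  then show ?case by (intro ext) simp
qed (auto intro!: ext)

text \<open>The column \<open>q\<close> carrying the extra cell moves as rows are added, hence the existential.\<close>

lemma heights_decrement_last:
  assumes "\<forall>x\<in>set xs. x \<le> k" "Suc a \<le> k"
  shows "\<exists>q\<ge>1. \<forall>j. heights k (xs @ [Suc a]) j
           = heights k (xs @ [a]) j + (if j = q then 1 else 0)"
  using assms(1)
proof (induction xs)
  case Nil
  have nil: "height_function (heights k [])"
    by (simp add: height_function_def)
  have "shift k b (heights k []) = 0" if "b \<le> k" for b
    using that by (intro shift_eqI nil) auto
  then show ?case
    using assms(2) by (intro exI[of _ "Suc a"]) auto
next
  case (Cons b xs)
  let ?c = "heights k (xs @ [Suc a])" and ?c' = "heights k (xs @ [a])"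
  let ?s = "shift k b ?c" and ?s' = "shift k b ?c'"
  have hf: "height_function ?c" "height_function ?c'" and b: "b \<le> k"
    using Cons.prems assms(2) by (auto intro!: height_function_heights)
  obtain q where q: "1 \<le> q" "\<And>j. ?c j = ?c' j + (if j = q then 1 else 0)"
    using Cons by auto
  have le: "?s' \<le> ?s"
    using q(2) by (intro shift_mono hf b) auto
  show ?case
  proof (cases "?s' = ?s")
    case True
    then show ?thesis
      using q by (intro exI[of _ q]) auto
  next
    case False
    \<comment> \<open>a column left of one copy of the row but not of the other one must be \<open>q\<close>, with its height
      just at the threshold; so the two shifts are \<open>q\<close> and \<open>q - 1\<close>\<close>
    have jump: "j = q \<and> ?c' j + b = k" if "?s' < j" "j \<le> ?s" for j
      using right_of_shift[OF hf(2) b that(1)] left_of_shift[OF hf(1) _ that(2)] that(1) q(2)[of j]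
      by (auto split: if_splits)
    have s: "?s = q" "Suc ?s' = q"
      using jump[of ?s] jump[of "Suc ?s'"] le False by auto
    show ?thesis
      \<comment> \<open>the rows are \<open>{q..<q + b}\<close> and \<open>{q<..q + b}\<close>: column \<open>q\<close> evens out, column \<open>q + b\<close> does not\<close>
      using s q by (intro exI[of _ "q + b"]) auto
  qed
qed

section \<open>The k-skew diagram and its column lengths\<close>

lemma part_0 [simp]: "part xs 0 = 0"
  by (simp add: part_def)

lemma part_beyond_length: "length xs < i \<Longrightarrow> part xs i = 0"
  by (simp add: part_def)

lemma part_antimono:
  assumes "is_partition xs" "1 \<le> i" "i \<le> j"
  shows "part xs j \<le> part xs i"
proof (cases "i < j \<and> j \<le> length xs")
  case True
  then show ?thesis
    using assms sorted_wrt_nth_less[of "(\<ge>)" xs "i - 1" "j - 1"]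
    by (auto simp: is_partition_def part_def)
next
  case False
  then show ?thesis
    using assms(3) by (auto simp: part_def)
qed

lemma partition_eqI:
  assumes "is_partition xs" "is_partition ys" "\<And>i. 1 \<le> i \<Longrightarrow> part xs i = part ys i"
  shows "xs = ys"
proof (rule nth_equalityI)
  have pos: "part zs i > 0 \<longleftrightarrow> 1 \<le> i \<and> i \<le> length zs" if "is_partition zs" for zs i
    using that by (auto simp: is_partition_def part_def)
  show len: "length xs = length ys"
    using pos[OF assms(1), of "length xs"] pos[OF assms(2), of "length xs"]
      pos[OF assms(1), of "length ys"] pos[OF assms(2), of "length ys"]
      assms(3)[of "length xs"] assms(3)[of "length ys"]
    by (cases "length xs = 0"; cases "length ys = 0") (auto simp: Suc_le_eq)
  show "xs ! i = ys ! i" if "i < length xs" for i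
    using assms(3)[of "Suc i"] that len by (simp add: part_def)
qed

text \<open>With \<open>k = a = 0\<close> the shift is the number of positive values.\<close>

lemma partition_of_height_function:
  assumes "height_function f"
  obtains p where "is_partition p" "\<And>i. 1 \<le> i \<Longrightarrow> part p i = f i"
proof
  let ?m = "shift 0 0 f"
  let ?p = "map f [1..<Suc ?m]"
  have pos: "0 < f i" if "1 \<le> i" "i \<le> ?m" for i
    using left_of_shift[OF assms that] by simp
  show "is_partition ?p"
    unfolding is_partition_def sorted_wrt_iff_nth_less
    using pos height_functionD[OF assms] by (auto simp del: upt_Suc)
  show "part ?p i = f i" if "1 \<le> i" for i
    using right_of_shift[OF assms, of 0 0 i] that by (auto simp: part_def simp del: upt_Suc)
qed

lemma bounded_partition_parts_le:
  assumes "xs \<in> bounded_partitions k"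
  shows "\<forall>x\<in>set xs. x \<le> k"
proof
  fix x assume "x \<in> set xs"
  then obtain i where "i < length xs" "x = part xs (Suc i)"
    by (auto simp: in_set_conv_nth part_def)
  then show "x \<le> k"
    using part_antimono[of xs 1 "Suc i"] assms by (auto simp: bounded_partitions_def)
qed

lemma bounded_partition_part_le:
  assumes "xs \<in> bounded_partitions k"
  shows "part xs i \<le> k"
  using bounded_partition_parts_le[OF assms] by (auto simp: part_def)

definition cells_above :: "nat list \<Rightarrow> nat list \<Rightarrow> nat \<Rightarrow> nat \<Rightarrow> nat" where
  "cells_above \<gamma> \<rho> i j = card {i'. i < i' \<and> (i', j) \<in> skew_cells \<gamma> \<rho>}"

lemma finite_column: "finite {i. P i \<and> (i, j) \<in> skew_cells \<gamma> \<rho>}"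
  by (rule finite_subset[of _ "{..length \<gamma>}"])
    (auto simp: skew_cells_def part_def split: if_splits)

lemma cells_above_step:
  "cells_above \<gamma> \<rho> i j = cells_above \<gamma> \<rho> (Suc i) j +
     (if part \<rho> (Suc i) < j \<and> j \<le> part \<gamma> (Suc i) then 1 else 0)"
proof -
  have "i < i' \<longleftrightarrow> i' = Suc i \<or> Suc i < i'" for i'
    by auto
  then have "{i'. i < i' \<and> (i', j) \<in> skew_cells \<gamma> \<rho>} = {i'. Suc i < i' \<and> (i', j) \<in> skew_cells \<gamma> \<rho>}
      \<union> (if part \<rho> (Suc i) < j \<and> j \<le> part \<gamma> (Suc i) then {Suc i} else {})"
    by (auto simp: skew_cells_def)
  then show ?thesis
    unfolding cells_above_def using finite_column[of "\<lambda>i'. Suc i < i'" j \<gamma> \<rho>] by auto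
qed

text \<open>The maximum accounts for squares below the diagram, whose arm consists of the whole row.\<close>

lemma hook_length_eq:
  "hook_length \<gamma> \<rho> (i, j)
     = (Suc (part \<gamma> i) - max (Suc (part \<rho> i)) j) + cells_above \<gamma> \<rho> i j"
proof -
  let ?R = "Pair i ` {max (Suc (part \<rho> i)) j..part \<gamma> i}"
  let ?C = "(\<lambda>i'. (i', j)) ` {i'. i < i' \<and> (i', j) \<in> skew_cells \<gamma> \<rho>}"
  have "{(i', j') \<in> skew_cells \<gamma> \<rho>. (i' = i \<and> j \<le> j') \<or> (j' = j \<and> i \<le> i')} = ?R \<union> ?C"
    by (auto simp: skew_cells_def Suc_le_eq image_iff)
  moreover have "card (?R \<union> ?C) = card ?R + card ?C"
    by (intro card_Un_disjoint finite_imageI finite_column) auto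
  moreover have "card ?R = Suc (part \<gamma> i) - max (Suc (part \<rho> i)) j"
    by (subst card_image) (auto simp: inj_on_def)
  moreover have "card ?C = cells_above \<gamma> \<rho> i j"
    unfolding cells_above_def by (rule card_image) (auto simp: inj_on_def)
  ultimately show ?thesis
    unfolding hook_length_def by simp
qed

text \<open>\<open>drop i xs\<close> consists of the rows strictly above row \<open>i\<close>.\<close>

definition row_offset :: "nat \<Rightarrow> nat list \<Rightarrow> nat \<Rightarrow> nat" where
  "row_offset k xs i = shift k (part xs i) (heights k (drop i xs))"

lemma height_function_drop:
  "xs \<in> bounded_partitions k \<Longrightarrow> height_function (heights k (drop i xs))"
  using bounded_partition_parts_le set_drop_subset[of i xs]
  by (intro height_function_heights) blast

lemma heights_drop_Suc:
  "heights k (drop i xs) j = heights k (drop (Suc i) xs) j +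
     (if row_offset k xs (Suc i) < j \<and> j \<le> row_offset k xs (Suc i) + part xs (Suc i)
      then 1 else 0)"
proof (cases "i < length xs")
  case True
  then show ?thesis
    by (simp add: Cons_nth_drop_Suc[symmetric] row_offset_def part_def)
qed (simp add: part_def)

lemma row_offset_beyond_length:
  assumes "xs \<in> bounded_partitions k" "length xs < i"
  shows "row_offset k xs i = 0"
  unfolding row_offset_def using assms(2)
  by (intro shift_eqI height_function_drop[OF assms(1)]) (auto simp: part_beyond_length)

lemma row_offset_antimono:
  assumes "xs \<in> bounded_partitions k" "1 \<le> i" "i \<le> j"
  shows "row_offset k xs j \<le> row_offset k xs i"
  using assms(3)
proof (induction rule: dec_induct)
  case (step n)
  have "row_offset k xs (Suc n) \<le> row_offset k xs n"
    unfolding row_offset_def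
  proof (rule shift_mono[OF height_function_drop[OF assms(1)] bounded_partition_part_le[OF assms(1)]])
    show "part xs (Suc n) \<le> part xs n"
      using assms(1,2) step by (intro part_antimono) (auto simp: bounded_partitions_def)
    show "heights k (drop (Suc n) xs) j \<le> heights k (drop n xs) j" for j
      by (subst (2) heights_drop_Suc) simp
  qed
  then show ?case using step by simp
qed simp

text \<open>Row \<open>i\<close> of \<open>\<gamma>/\<rho>\<close> is where the construction from the top down puts it.\<close>

definition rows_by_offset :: "nat \<Rightarrow> nat list \<Rightarrow> nat list \<Rightarrow> nat list \<Rightarrow> nat \<Rightarrow> bool" where
  "rows_by_offset k xs \<gamma> \<rho> i \<longleftrightarrow>
     part \<rho> i = row_offset k xs i \<and> part \<gamma> i = row_offset k xs i + part xs i"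

lemma cells_above_eq_heights_beyond_length:
  assumes "\<And>i. length xs < i \<Longrightarrow> part \<gamma> i = part \<rho> i" "length xs \<le> i"
  shows "cells_above \<gamma> \<rho> i j = heights k (drop i xs) j"
proof -
  have "{i'. i < i' \<and> (i', j) \<in> skew_cells \<gamma> \<rho>} = {}"
    using assms by (auto simp: skew_cells_def)
  then have "cells_above \<gamma> \<rho> i j = 0"
    unfolding cells_above_def by (metis card.empty)
  then show ?thesis
    using assms(2) by simp
qed

lemma cells_above_eq_heights_step:
  assumes "rows_by_offset k xs \<gamma> \<rho> (Suc i)"
    and "cells_above \<gamma> \<rho> (Suc i) j = heights k (drop (Suc i) xs) j"
  shows "cells_above \<gamma> \<rho> i j = heights k (drop i xs) j"
  using assms by (simp add: cells_above_step[of \<gamma> \<rho> i] heights_drop_Suc[of k i] rows_by_offset_def)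

lemma cells_above_eq_heights:
  assumes "xs \<in> bounded_partitions k" "\<And>i. 1 \<le> i \<Longrightarrow> rows_by_offset k xs \<gamma> \<rho> i"
  shows "cells_above \<gamma> \<rho> i j = heights k (drop i xs) j"
proof (induction "length xs - i" arbitrary: i)
  case 0
  then show ?case
    using assms(2) by (intro cells_above_eq_heights_beyond_length)
      (auto simp: part_beyond_length rows_by_offset_def)
next
  case (Suc n)
  then show ?case
    using assms(2) by (auto intro: cells_above_eq_heights_step[of k xs \<gamma> \<rho> i j])
qed

text \<open>Downward induction on the row: once all rows above row \<open>i\<close> are known, the columns above it have the
  constructed heights. The hooks of the first cell of the row and of the squares to its left then
  leave only one position. Rows above the length are empty, and a square
  of \<open>\<rho>\<close> there would have hook-length 0.\<close>

lemma is_k_skewD: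
  assumes xs: "xs \<in> bounded_partitions k" and skew: "is_k_skew k xs \<gamma> \<rho>" and i: "1 \<le> i"
  shows "rows_by_offset k xs \<gamma> \<rho> i"
proof -
  have row: "part \<gamma> i = part \<rho> i + part xs i" if "1 \<le> i" for i
  proof -
    have "{j. (i, j) \<in> skew_cells \<gamma> \<rho>} = {part \<rho> i<..part \<gamma> i}"
      by (auto simp: skew_cells_def)
    moreover have "part \<rho> i \<le> part \<gamma> i" "card {j. (i, j) \<in> skew_cells \<gamma> \<rho>} = part xs i"
      using skew that by (auto simp: is_k_skew_def contained_def)
    ultimately show ?thesis by simp
  qed
  have cell: "hook_length \<gamma> \<rho> c \<le> k" if "c \<in> skew_cells \<gamma> \<rho>" for c
    using skew that by (auto simp: is_k_skew_def)
  have below: "k < hook_length \<gamma> \<rho> c" if "c \<in> diagram \<rho>" for c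
    using skew that by (auto simp: is_k_skew_def)
  have above_0: "cells_above \<gamma> \<rho> i j = heights k (drop i xs) j" if "length xs \<le> i" for i j
    using row that by (intro cells_above_eq_heights_beyond_length) (auto simp: part_beyond_length)
  have beyond: "part \<rho> i = 0" if "length xs < i" for i
  proof (rule ccontr)
    assume "part \<rho> i \<noteq> 0"
    then have "k < hook_length \<gamma> \<rho> (i, 1)"
      by (intro below) (auto simp: diagram_def)
    then show False
      using row[of i] above_0[of i 1] that by (simp add: hook_length_eq part_beyond_length)
  qed
  have offset: "part \<rho> i = row_offset k xs i"
    if i: "1 \<le> i" "i \<le> length xs" and above: "\<And>j. cells_above \<gamma> \<rho> i j = heights k (drop i xs) j" for i
    \<comment> \<open>positivity of the part is what provides a first cell in the row\<close>
    unfolding row_offset_def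
  proof (rule shift_eqI[symmetric])
    have "0 < part xs i"
      using xs i by (auto simp: bounded_partitions_def is_partition_def part_def)
    then show "heights k (drop i xs) (Suc (part \<rho> i)) + part xs i \<le> k"
      using cell[of "(i, Suc (part \<rho> i))"] row[OF i(1)] above[of "Suc (part \<rho> i)"]
      by (simp add: skew_cells_def hook_length_eq)
    show "k < heights k (drop i xs) j + part xs i" if "1 \<le> j" "j \<le> part \<rho> i" for j
      using below[of "(i, j)"] row[OF i(1)] above[of j] that
      by (simp add: diagram_def hook_length_eq max_def)
  qed (use xs height_function_drop bounded_partition_part_le in auto)
  have above: "\<forall>j. cells_above \<gamma> \<rho> i j = heights k (drop i xs) j" for i
  proof (induction "length xs - i" arbitrary: i)
    case 0
    then show ?case using above_0 by auto
  next
    case (Suc n)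
    then have "rows_by_offset k xs \<gamma> \<rho> (Suc i)"
      using offset[of "Suc i"] row[of "Suc i"] by (auto simp: rows_by_offset_def)
    then show ?case
      using Suc(1)[of "Suc i"] Suc(2) by (auto intro: cells_above_eq_heights_step[of k xs \<gamma> \<rho> i])
  qed
  show ?thesis
    using offset[OF i] above beyond row[OF i] row_offset_beyond_length[OF xs]
    by (cases "i \<le> length xs") (auto simp: rows_by_offset_def)
qed

text \<open>Conversely, with \<open>c\<close> the heights above row \<open>i\<close> and \<open>a\<close> its length, a square \<open>(i, j)\<close> of \<open>\<rho>\<close> has
  hook-length \<open>c j + a\<close>, and a cell \<open>(i, j)\<close> of the diagram at most that. The defining property of
  the shift is that it separates the columns by whether this number exceeds \<open>k\<close>.\<close>

lemma is_k_skewI: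
  assumes xs: "xs \<in> bounded_partitions k"
    and partitions: "is_partition \<gamma>" "is_partition \<rho>"
    and rows: "\<And>i. 1 \<le> i \<Longrightarrow> rows_by_offset k xs \<gamma> \<rho> i"
  shows "is_k_skew k xs \<gamma> \<rho>"
proof -
  note above = cells_above_eq_heights[OF xs rows]
  have row: "part \<rho> i = row_offset k xs i" "part \<gamma> i = part \<rho> i + part xs i" if "1 \<le> i" for i
    using rows[OF that] by (auto simp: rows_by_offset_def)
  have "{j. (i, j) \<in> skew_cells \<gamma> \<rho>} = {part \<rho> i<..part \<gamma> i}" for i
    by (auto simp: skew_cells_def)
  then have card: "card {j. (i, j) \<in> skew_cells \<gamma> \<rho>} = part xs i" if "1 \<le> i" for i
    using row[OF that] by simp
  have cell: "hook_length \<gamma> \<rho> (i, j) \<le> k" if "(i, j) \<in> skew_cells \<gamma> \<rho>" for i j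
  proof -
    have "1 \<le> i" and j: "part \<rho> i < j"
      using that by (auto simp: skew_cells_def Suc_le_eq intro!: gr0I)
    note row = row[OF this(1)]
    have "heights k (drop i xs) j + part xs i \<le> k"
      using j row unfolding row_offset_def
      by (intro right_of_shift[OF height_function_drop] bounded_partition_part_le xs) auto
    then show ?thesis
      using row j by (simp add: hook_length_eq above)
  qed
  have below: "k < hook_length \<gamma> \<rho> (i, j)" if "(i, j) \<in> diagram \<rho>" for i j
  proof -
    have "1 \<le> i" and j: "1 \<le> j" "j \<le> part \<rho> i"
      using that by (auto simp: diagram_def Suc_le_eq intro!: gr0I)
    note row = row[OF this(1)]
    have "k < heights k (drop i xs) j + part xs i"
      using j row unfolding row_offset_def
      by (intro left_of_shift[OF height_function_drop] xs) auto
    then show ?thesis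
      using row j by (simp add: hook_length_eq above max_def)
  qed
  show ?thesis
    unfolding is_k_skew_def contained_def using partitions card cell below row by auto
qed

text \<open>Both \<open>\<rho>\<close> and \<open>\<gamma>\<close> are partitions since a longer row over higher columns starts
  further to the right.\<close>

lemma k_skew_exists:
  assumes xs: "xs \<in> bounded_partitions k"
  obtains \<gamma> \<rho> where "is_k_skew k xs \<gamma> \<rho>"
proof -
  have zero: "\<forall>i>length xs. row_offset k xs i = 0 \<and> part xs i = 0"
    using row_offset_beyond_length[OF xs] by (auto simp: part_beyond_length)
  have "is_partition xs"
    using xs by (simp add: bounded_partitions_def)
  note mono = row_offset_antimono[OF xs] part_antimono[OF this]
  have hf: "height_function (row_offset k xs)"
    "height_function (\<lambda>i. row_offset k xs i + part xs i)"
    unfolding height_function_def using mono zero by (auto intro!: add_mono exI[of _ "length xs"])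
  obtain \<rho> where \<rho>: "is_partition \<rho>" "\<And>i. 1 \<le> i \<Longrightarrow> part \<rho> i = row_offset k xs i"
    using partition_of_height_function[OF hf(1)] by blast
  obtain \<gamma> where \<gamma>: "is_partition \<gamma>"
      "\<And>i. 1 \<le> i \<Longrightarrow> part \<gamma> i = row_offset k xs i + part xs i"
    using partition_of_height_function[OF hf(2)] by blast
  show ?thesis
    using \<rho> \<gamma> by (intro that[of \<gamma> \<rho>] is_k_skewI[OF xs]) (auto simp: rows_by_offset_def)
qed

lemma k_skew_eqI:
  assumes xs: "xs \<in> bounded_partitions k" and skew: "is_k_skew k xs \<gamma> \<rho>"
  shows "k_skew k xs = (\<gamma>, \<rho>)"
  unfolding k_skew_def
proof (rule the_equality)
  show "case (\<gamma>, \<rho>) of (\<gamma>, \<rho>) \<Rightarrow> is_k_skew k xs \<gamma> \<rho>"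
    using skew by simp
  fix p assume "case p of (\<gamma>, \<rho>) \<Rightarrow> is_k_skew k xs \<gamma> \<rho>"
  then obtain \<gamma>' \<rho>' where p: "p = (\<gamma>', \<rho>')" "is_k_skew k xs \<gamma>' \<rho>'"
    by (cases p) auto
  have "\<gamma>' = \<gamma>" "\<rho>' = \<rho>"
    using is_k_skewD[OF xs skew] is_k_skewD[OF xs p(2)] skew p(2)
    by (auto intro!: partition_eqI simp: is_k_skew_def rows_by_offset_def)
  then show "p = (\<gamma>, \<rho>)" using p by simp
qed

lemma part_k_conjugate:
  assumes xs: "xs \<in> bounded_partitions k" and j: "1 \<le> j"
  shows "part (k_conjugate k xs) j = heights k xs j"
proof -
  obtain \<gamma> \<rho> where skew: "is_k_skew k xs \<gamma> \<rho>"
    using k_skew_exists[OF xs] .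
  have heights: "cells_above \<gamma> \<rho> 0 j = heights k xs j" for j
    using cells_above_eq_heights[OF xs is_k_skewD[OF xs skew], of 0] by simp
  have "{i. (i, j) \<in> skew_cells \<gamma> \<rho>} = {i. 0 < i \<and> (i, j) \<in> skew_cells \<gamma> \<rho>}" for j
    by (auto simp: skew_cells_def intro!: gr0I)
  then have column: "card {i. (i, j) \<in> skew_cells \<gamma> \<rho>} = heights k xs j" for j
    unfolding heights[symmetric] cells_above_def by metis
  have conj: "k_conjugate k xs = map (heights k xs) [1..<Suc (part \<gamma> 1)]"
    unfolding k_conjugate_def k_skew_eqI[OF xs skew] by (simp add: column)
  have "heights k xs j = 0" if "part \<gamma> 1 < j"
  proof -
    have "is_partition \<gamma>"
      using skew unfolding is_k_skew_def by blast
    then have "part \<gamma> i < j" if "0 < i" for i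
      using part_antimono[of \<gamma> 1 i] that \<open>part \<gamma> 1 < j\<close> by linarith
    then have "{i. 0 < i \<and> (i, j) \<in> skew_cells \<gamma> \<rho>} = {}"
      by (auto simp: skew_cells_def not_le)
    then show ?thesis
      unfolding heights[symmetric] cells_above_def by (metis card.empty)
  qed
  then show ?thesis
    using j unfolding conj by (auto simp: part_def simp del: upt_Suc)
qed

section \<open>Every nonempty partition covers another one\<close>

text \<open>If the last part is 1, decrementing it yields a zero part, which has to be dropped; this does not
  change the heights.\<close>

lemma Y_cover_decrement_last:
  assumes ys: "ys \<in> bounded_partitions k" and "ys \<noteq> []"
  shows "\<exists>xs. Y_cover k xs ys"
proof -
  obtain zs b where "ys = zs @ [b]"
    using \<open>ys \<noteq> []\<close> by (metis rev_exhaust)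
  moreover have "b \<noteq> 0"
    using ys calculation by (auto simp: bounded_partitions_def is_partition_def)
  ultimately obtain a where zs: "ys = zs @ [Suc a]"
    using not0_implies_Suc by blast
  define xs where "xs = (if a = 0 then zs else zs @ [a])"
  have part: "part xs i = part (zs @ [a]) i" for i
    by (auto simp: xs_def part_def nth_append)
  have le: "part xs i \<le> part ys i" for i
    unfolding part zs by (auto simp: part_def nth_append)
  have heights_xs: "heights k xs = heights k (zs @ [a])"
    by (simp add: xs_def heights_snoc_0)
  have "is_partition xs"
    using ys by (auto simp: bounded_partitions_def is_partition_def xs_def zs sorted_wrt_append)
  then have xs: "xs \<in> bounded_partitions k"
    using ys le[of 1] by (auto simp: bounded_partitions_def)
  have "\<forall>x\<in>set zs. x \<le> k" "Suc a \<le> k"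
    using bounded_partition_parts_le[OF ys] by (auto simp: zs)
  then have "heights k xs j \<le> heights k ys j" for j
    using heights_decrement_last[of zs k a] by (auto simp: heights_xs zs)
  then have "contained (k_conjugate k xs) (k_conjugate k ys)"
    by (simp add: contained_def part_k_conjugate xs ys)
  moreover have "sum_list ys = sum_list xs + 1"
    by (simp add: xs_def zs)
  ultimately show ?thesis
    using xs ys le by (auto simp: Y_cover_def contained_def)
qed

section \<open>Maximal chains in ranked order ideals\<close>

lemma rank_mono:
  fixes rk :: "'a \<Rightarrow> nat"
  assumes "R\<^sup>*\<^sup>* x y" "\<And>x y. R x y \<Longrightarrow> rk y = Suc (rk x)"
  shows "rk x \<le> rk y \<and> (rk x = rk y \<longrightarrow> x = y)"
  using assms(1)
proof induction
  case (step y z)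
  then show ?case using assms(2)[OF step.hyps(2)] by auto
qed simp

lemma intermediate_rank:
  fixes rk :: "'a \<Rightarrow> nat"
  assumes "R\<^sup>*\<^sup>* x y" "\<And>x y. R x y \<Longrightarrow> rk y = Suc (rk x)" "rk x \<le> r" "r \<le> rk y"
  shows "\<exists>z. R\<^sup>*\<^sup>* x z \<and> R\<^sup>*\<^sup>* z y \<and> rk z = r"
  using assms(1,4)
proof induction
  case base
  then show ?case using assms(3) by auto
next
  case (step y z)
  show ?case
  proof (cases "r = rk z")
    case True
    then show ?thesis using step(1,2) by (auto intro!: exI[of _ z])
  next
    case False
    then have "r \<le> rk y" using step assms(2)[of y z] by simp
    then show ?thesis using step by (blast intro: rtranclp.rtrancl_into_rtrancl)
  qed
qed

lemma lower_rank_exists: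
  fixes rk :: "'a \<Rightarrow> nat"
  assumes rk: "\<And>x y. R x y \<Longrightarrow> rk y = Suc (rk x)"
    and ideal: "\<And>x y. R x y \<Longrightarrow> y \<in> A \<Longrightarrow> x \<in> A"
    and down: "\<And>y. y \<in> A \<Longrightarrow> 0 < rk y \<Longrightarrow> \<exists>x. R x y"
    and "y \<in> A" "r \<le> rk y"
  shows "\<exists>z. R\<^sup>*\<^sup>* z y \<and> rk z = r"
  using assms(4,5)
proof (induction "rk y" arbitrary: y)
  case 0
  then show ?case by auto
next
  case (Suc n)
  obtain x where x: "R x y"
    using down Suc by (metis zero_less_Suc)
  show ?case
  proof (cases "r = rk y")
    case False
    then have "\<exists>z. R\<^sup>*\<^sup>* z x \<and> rk z = r"
      using Suc rk[OF x] ideal[OF x] by auto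
    then show ?thesis using x by (blast intro: rtranclp.rtrancl_into_rtrancl)
  qed auto
qed

text \<open>If a chain misses the rank \<open>r\<close>, let \<open>u\<close> be its lowest element above rank \<open>r\<close>, or the top
  element, and let \<open>d\<close> be its highest element below rank \<open>r\<close>, if there is one. A saturated path from
  \<open>d\<close> to \<open>u\<close>, or a descent from \<open>u\<close>, passes through an element of rank \<open>r\<close> that can be added to the
  chain.\<close>

lemma card_maxchain_ranked_ideal:
  fixes rk :: "'a \<Rightarrow> nat"
  assumes rk: "\<And>x y. R x y \<Longrightarrow> rk y = Suc (rk x)"
    and ideal: "\<And>x y. R x y \<Longrightarrow> y \<in> A \<Longrightarrow> x \<in> A"
    and down: "\<And>y. y \<in> A \<Longrightarrow> 0 < rk y \<Longrightarrow> \<exists>x. R x y"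
    and top: "t \<in> A" "\<And>x. x \<in> A \<Longrightarrow> R\<^sup>*\<^sup>* x t"
    and max: "pred_on.maxchain A R\<^sup>*\<^sup>* C"
  shows "card C = rk t + 1"
proof -
  note mono = rank_mono[where R = R and rk = rk, OF _ rk]
  have chain: "C \<subseteq> A" "\<And>x y. x \<in> C \<Longrightarrow> y \<in> C \<Longrightarrow> R\<^sup>*\<^sup>* x y \<or> R\<^sup>*\<^sup>* y x"
    using max by (auto simp: pred_on.maxchain_def pred_on.chain_def)
  have maximal: "z \<in> C" if "z \<in> A" "\<And>x. x \<in> C \<Longrightarrow> R\<^sup>*\<^sup>* x z \<or> R\<^sup>*\<^sup>* z x" for z
  proof (rule ccontr)
    assume "z \<notin> C"
    moreover have "pred_on.chain A R\<^sup>*\<^sup>* (insert z C)"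
      unfolding pred_on.chain_def using chain that by auto
    ultimately show False
      using max by (auto simp: pred_on.maxchain_def)
  qed
  have by_rank: "R\<^sup>*\<^sup>* x y" if "x \<in> C" "y \<in> C" "rk x \<le> rk y" for x y
    using chain(2)[OF that(1,2)] mono[of x y] mono[of y x] that(3) by auto
  have inj: "inj_on rk C"
    using chain(2) mono by (metis inj_onI)
  have ideal': "x \<in> A" if "R\<^sup>*\<^sup>* x y" "y \<in> A" for x y
    using that by (induction rule: converse_rtranclp_induct) (auto dest: ideal)
  have sub: "rk ` C \<subseteq> {..rk t}"
    using chain(1) top(2) mono by blast
  have "r \<in> rk ` C" if r: "r \<le> rk t" for r
  proof (rule ccontr)
    assume nr: "r \<notin> rk ` C"
    have "\<exists>u\<in>A. r \<le> rk u \<and> (\<forall>x\<in>C. r < rk x \<longrightarrow> R\<^sup>*\<^sup>* u x) \<and> (\<forall>x\<in>C. rk x < r \<longrightarrow> R\<^sup>*\<^sup>* x u)"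
    proof (cases "\<exists>x\<in>C. r < rk x")
      case True
      then obtain u where "u \<in> C" "r < rk u" "\<forall>x\<in>C. r < rk x \<longrightarrow> rk u \<le> rk x"
        using ex_has_least_nat[of "\<lambda>x. x \<in> C \<and> r < rk x" _ rk] by blast
      then show ?thesis
        using chain(1) by_rank by (intro bexI[of _ u]) auto
    next
      case False
      then show ?thesis
        using chain(1) top r by (intro bexI[of _ t]) auto
    qed
    then obtain u where u: "u \<in> A" "r \<le> rk u" "\<And>x. x \<in> C \<Longrightarrow> r < rk x \<Longrightarrow> R\<^sup>*\<^sup>* u x"
      "\<And>x. x \<in> C \<Longrightarrow> rk x < r \<Longrightarrow> R\<^sup>*\<^sup>* x u"
      by blast
    have "\<exists>z. R\<^sup>*\<^sup>* z u \<and> rk z = r \<and> (\<forall>x\<in>C. rk x < r \<longrightarrow> R\<^sup>*\<^sup>* x z)"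
    proof (cases "\<exists>x\<in>C. rk x < r")
      case True
      then obtain d where d: "d \<in> C" "rk d < r" "\<forall>x\<in>C. rk x < r \<longrightarrow> rk x \<le> rk d"
        using ex_has_greatest_nat[of "\<lambda>x. x \<in> C \<and> rk x < r" _ rk r] by (metis less_imp_le)
      have "\<exists>z. R\<^sup>*\<^sup>* d z \<and> R\<^sup>*\<^sup>* z u \<and> rk z = r"
        using d(2) u(2) by (intro intermediate_rank[OF u(4)[OF d(1,2)] rk]) auto
      moreover have "R\<^sup>*\<^sup>* x d" if "x \<in> C" "rk x < r" for x
        using by_rank d that by auto
      ultimately show ?thesis
        by (blast intro: rtranclp_trans)
    next
      case False
      then show ?thesis
        using lower_rank_exists[of R rk A u r] rk ideal down u(1,2) by blast
    qed
    then obtain z where z: "R\<^sup>*\<^sup>* z u" "rk z = r" "\<And>x. x \<in> C \<Longrightarrow> rk x < r \<Longrightarrow> R\<^sup>*\<^sup>* x z"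
      by blast
    have "z \<in> C"
    proof (rule maximal)
      show "z \<in> A" using ideal' z(1) u(1) .
      fix x assume "x \<in> C"
      moreover from this have "rk x \<noteq> r" using nr by auto
      ultimately show "R\<^sup>*\<^sup>* x z \<or> R\<^sup>*\<^sup>* z x"
        using z u(3) by (metis linorder_neqE_nat rtranclp_trans)
    qed
    then show False using nr z(2) by blast
  qed
  with sub have "rk ` C = {..rk t}" by blast
  then show ?thesis
    using card_image[OF inj] by simp
qed

section \<open>The ideal generated by a rectangle\<close>

lemma finite_partitions_sum_le: "finite {xs. is_partition xs \<and> sum_list xs \<le> N}"
proof (rule finite_subset)
  have "length xs \<le> sum_list xs" if "\<forall>x\<in>set xs. 0 < x" for xs :: "nat list"
    using that by (induction xs) auto
  moreover have "x \<le> sum_list xs" if "x \<in> set xs" for x and xs :: "nat list"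
    using that by (simp add: member_le_sum_list)
  ultimately show "{xs. is_partition xs \<and> sum_list xs \<le> N}
      \<subseteq> {xs. set xs \<subseteq> {..N} \<and> length xs \<le> N}"
    by (force simp: is_partition_def)
  show "finite {xs. set xs \<subseteq> {..N} \<and> length xs \<le> N}"
    by (rule finite_lists_length_le) simp
qed

theorem corollary26:
  fixes k m n :: nat
  assumes "1 \<le> k" and "1 \<le> m" and "1 \<le> n" and "m \<le> k"
  shows "graded_poset_of_rank (L_ideal k m n) (Y_le k) (m * n)"
proof -
  let ?A = "L_ideal k m n" and ?t = "replicate n m"
  have t: "?t \<in> ?A"
    using assms by (auto simp: L_ideal_def bounded_partitions_def is_partition_def part_def Y_le_def
        sorted_wrt_iff_nth_less)
  have rk: "sum_list y = Suc (sum_list x)" if "Y_cover k x y" for x y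
    using that by (simp add: Y_cover_def)
  note mono = rank_mono[where R = "Y_cover k" and rk = sum_list, OF _ rk]
  have le_t: "(Y_cover k)\<^sup>*\<^sup>* x ?t" "x \<in> bounded_partitions k" if "x \<in> ?A" for x
    using that by (auto simp: L_ideal_def Y_le_def)
  have "finite ?A"
  proof (rule finite_subset[OF _ finite_partitions_sum_le])
    show "?A \<subseteq> {xs. is_partition xs \<and> sum_list xs \<le> sum_list ?t}"
      using le_t mono by (fastforce simp: bounded_partitions_def)
  qed
  moreover have "partial_order_on ?A {(x, y). x \<in> ?A \<and> y \<in> ?A \<and> Y_le k x y}"
    unfolding partial_order_on_def preorder_on_def refl_on_def trans_def antisym_def Y_le_def
    using mono by (auto intro: rtranclp_trans) (metis le_antisym)
  moreover have "card C = m * n + 1" if "pred_on.maxchain ?A (Y_le k) C" for C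
  proof -
    have "card C = sum_list ?t + 1"
    proof (rule card_maxchain_ranked_ideal[where R = "Y_cover k" and A = ?A])
      show "x \<in> ?A" if "Y_cover k x y" "y \<in> ?A" for x y
        using that by (auto simp: L_ideal_def Y_le_def Y_cover_def
            intro: converse_rtranclp_into_rtranclp)
      show "\<exists>x. Y_cover k x y" if "y \<in> ?A" "0 < sum_list y" for y
        using Y_cover_decrement_last[OF le_t(2)[OF that(1)]] that(2) by fastforce
      show "pred_on.maxchain ?A (Y_cover k)\<^sup>*\<^sup>* C"
        using that by (simp add: Y_le_def)
    qed (use rk t le_t in auto)
    then show ?thesis by (simp add: sum_list_replicate mult.commute)
  qed
  ultimately show ?thesis
    by (simp add: graded_poset_of_rank_def)
qed

end
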